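(* Let $A(x,y)=A_0+\sum_{p=1}^dx_pA_p+\sum_{q=1}^my_qA'_q\in\mathcal{S}^k[x,y]$ and $B(x)=B_0+\sum_{p=1}^dx_pB_p\in\mathcal{S}^l[x]$ be linear pencils. Assume $A(x,y)$ is strictly feasible. The following are equivalent. (1) $B(x)\in\mathcal{M}^l_0(\pi A)$. (2) There exist $C'\in\mathcal{S}^{kl}_+$ and $C'_0\in\mathcal{S}^l_+$ such that $B_0=C'_0+\langle A_0,C'\rangle_l$, $B_p=\langle A_p,C'\rangle_l$ for all $p\in\{1,\dots,d\}$, and $0=\langle A'_q,C'\rangle_l$ for all $q\in\{1,\dots,m\}$. (3) There exist $C=(C_{ij})_{i,j=1}^k\in\mathcal{S}^{kl}_+$ (with $l\times l$ blocks $C_{ij}$) and $C_0\in\mathcal{S}^l_+$ such that $B_0=C_0+\sum_{i,j=1}^k(A_0)_{ij}C_{ij}$, $B_p=\sum_{i,j=1}^k(A_p)_{ij}C_{ij}$ for all $p\in\{1,\dots,d\}$, and $0=\sum_{i,j=1}^k(A'_q)_{ij}C_{ij}$ for all $q\in\{1,\dots,m\}$.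
   Context: $\mathcal{S}^k$ is the space of real symmetric $k\times k$ matrices, $\mathcal{S}^k_+$ the cone of positive semidefinite ones. A linear pencil is a matrix polynomial of degree at most one with symmetric coefficients, as displayed; it is strictly feasible if $A(x,y)\succ0$ for some $(x,y)\in\mathbb{R}^{d+m}$. For a symmetric $kl\times kl$ matrix $M=(M_{ij})_{i,j=1}^l$ with $k\times k$ blocks $M_{ij}$ and a symmetric $k\times k$ matrix $N$, the $l$th scalar product is the $l\times l$ matrix $\langle M,N\rangle_l=\langle N,M\rangle_l:=(\langle M_{ij},N\rangle)_{i,j=1}^l$, with $\langle\cdot,\cdot\rangle$ the Euclidean (trace) inner product. $\mathcal{M}^l_0(\pi A)$ is the degree-zero truncation of the quadratic module $\mathcal{M}^l(\pi A)$, in which the sum of squares matrices are constant positive semidefinite matrices: $$\mathcal{M}^l_0(\pi A)=\left\{S_0+\langle S,A(x,0)\rangle_l\ \middle|\ \langle S,A'_i\rangle_l=0\ \forall i\in\{1,\dots,m\},\ S_0\in\mathcal{S}^l_+,\ S\in\mathcal{S}^{kl}_+\right\}.$$ *)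

theory Defs
  imports "HOL-Analysis.Analysis" "HOL-Library.Poly_Mapping"
begin

(* S^n is the set of matrices of type real^'n^'n satisfying symmetric. *)

definition symmetric :: "real^'n^'n \<Rightarrow> bool" where
  "symmetric M \<longleftrightarrow> transpose M = M"

definition psd :: "real^'n^'n \<Rightarrow> bool" where
  "psd M \<longleftrightarrow> symmetric M \<and> (\<forall>v. 0 \<le> v \<bullet> (M *v v))"

definition posdef :: "real^'n^'n \<Rightarrow> bool" where
  "posdef M \<longleftrightarrow> symmetric M \<and> (\<forall>v. v \<noteq> 0 \<longrightarrow> 0 < v \<bullet> (M *v v))"

(* Block matrices are indexed by pairs (block index, index inside the block): a kl x kl matrix
   with l x l many blocks of size k x k has type real^('l \<times> 'k)^('l \<times> 'k), and one with k x k many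
   blocks of size l x l has type real^('k \<times> 'l)^('k \<times> 'l). *)

definition block :: "real^('b::finite \<times> 'n::finite)^('b \<times> 'n) \<Rightarrow> 'b \<Rightarrow> 'b \<Rightarrow> real^'n^'n" where
  "block M i j = (\<chi> a b. M $ (i, a) $ (j, b))"

(* The l-th scalar product <M,N>_l = <N,M>_l.  The library inner product on real^'k^'k is the sum of
   the products of corresponding entries, which is the trace inner product. *)

definition block_inner :: "real^('l::finite \<times> 'k::finite)^('l \<times> 'k) \<Rightarrow> real^'k^'k \<Rightarrow> real^'l^'l" where
  "block_inner M N = (\<chi> i j. block M i j \<bullet> N)"

(* Matrix polynomials are finitely supported families of coefficient matrices indexed by monomials
   in the variables X 1, X 2, ... and Y 1, Y 2, ...; a matrix polynomial in x alone is one in which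
   no Y occurs. *)

datatype var = X nat | Y nat

type_synonym 'a mpoly = "(var \<Rightarrow>\<^sub>0 nat) \<Rightarrow>\<^sub>0 'a"

definition const_poly :: "'a::zero \<Rightarrow> 'a mpoly" where
  "const_poly c = Poly_Mapping.single 0 c"

definition var_poly :: "var \<Rightarrow> 'a::zero \<Rightarrow> 'a mpoly" where
  "var_poly v c = Poly_Mapping.single (Poly_Mapping.single v 1) c"

definition poly_eval :: "(nat \<Rightarrow> real) \<Rightarrow> (nat \<Rightarrow> real) \<Rightarrow> 'a::real_vector mpoly \<Rightarrow> 'a" where
  "poly_eval x y P =
     (\<Sum>\<mu> \<in> Poly_Mapping.keys P.
        (\<Prod>v \<in> Poly_Mapping.keys \<mu>. (case v of X p \<Rightarrow> x p | Y q \<Rightarrow> y q) ^ Poly_Mapping.lookup \<mu> v)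
          *\<^sub>R Poly_Mapping.lookup P \<mu>)"

(* P(x,0): substituting 0 for all Y variables deletes exactly the terms in which some Y occurs. *)

definition y_zero :: "'a::comm_monoid_add mpoly \<Rightarrow> 'a mpoly" where
  "y_zero P =
     (\<Sum>\<mu> | \<mu> \<in> Poly_Mapping.keys P \<and> (\<forall>q. Y q \<notin> Poly_Mapping.keys \<mu>).
        Poly_Mapping.single \<mu> (Poly_Mapping.lookup P \<mu>))"

(* <S,P>_l for a matrix polynomial P, taken coefficientwise. *)

definition block_inner_poly ::
    "real^('l::finite \<times> 'k::finite)^('l \<times> 'k) \<Rightarrow> (real^'k^'k) mpoly \<Rightarrow> (real^'l^'l) mpoly" where
  "block_inner_poly S P = Poly_Mapping.map (block_inner S) P"

definition pencil_x :: "nat \<Rightarrow> 'a::comm_monoid_add \<Rightarrow> (nat \<Rightarrow> 'a) \<Rightarrow> 'a mpoly" where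
  "pencil_x d B0 B = const_poly B0 + (\<Sum>p\<in>{1..d}. var_poly (X p) (B p))"

definition pencil_xy ::
    "nat \<Rightarrow> nat \<Rightarrow> 'a::comm_monoid_add \<Rightarrow> (nat \<Rightarrow> 'a) \<Rightarrow> (nat \<Rightarrow> 'a) \<Rightarrow> 'a mpoly" where
  "pencil_xy d m A0 A A' =
     const_poly A0 + (\<Sum>p\<in>{1..d}. var_poly (X p) (A p)) + (\<Sum>q\<in>{1..m}. var_poly (Y q) (A' q))"

definition strictly_feasible :: "(real^'n^'n) mpoly \<Rightarrow> bool" where
  "strictly_feasible P \<longleftrightarrow> (\<exists>x y. posdef (poly_eval x y P))"

(* The truncated quadratic module M^l_0(pi A) for A = pencil_xy d m A0 A A'; l is the cardinality of
   the index type 'l of the elements. *)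

definition trunc_quadratic_module ::
    "nat \<Rightarrow> nat \<Rightarrow> real^'k^'k \<Rightarrow> (nat \<Rightarrow> real^'k^'k) \<Rightarrow> (nat \<Rightarrow> real^'k^'k) \<Rightarrow>
      (real^'l^'l) mpoly set" where
  "trunc_quadratic_module d m A0 A A' =
     {const_poly S0 + block_inner_poly S (y_zero (pencil_xy d m A0 A A')) | S0 S.
        (\<forall>i\<in>{1..m}. block_inner S (A' i) = 0) \<and> psd S0 \<and> psd S}"

end

theory Submission
  imports Defs
begin

text \<open>
  Two observations give the equivalences.

  A linear pencil determines its coefficients (\<open>pencil_x_eq_iff\<close>). Setting the variables \<open>Y q\<close>
  to zero in \<open>A(x,y)\<close> and pairing the result with \<open>S\<close> are both additive operations on matrix
  polynomials, so \<open>S0 + \<langle>S, A(x,0)\<rangle>\<close> is again a pencil in \<open>x\<close>, with constant coefficient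
  \<open>S0 + \<langle>S, A0\<rangle>\<close> and linear coefficients \<open>\<langle>S, A p\<rangle>\<close>. Membership of \<open>B(x)\<close> in the truncated
  quadratic module is therefore the comparison of coefficients in (2), with \<open>C' = S\<close>
  and \<open>C0' = S0\<close>; the equations \<open>\<langle>S, A' q\<rangle> = 0\<close> occur on both sides.

  Statements (2) and (3) differ only in whether a matrix on the tensor product of the two index
  sets is cut into blocks along the first or along the second factor. Exchanging the factors in
  row and column indices simultaneously is a congruence by a permutation matrix, so it keeps
  positive semidefiniteness (\<open>psd_reindex\<close>), and it turns the \<open>l\<close>-th scalar product into the
  combination of blocks in (3) (\<open>block_inner_eq_sum_block_swap\<close>).
\<close>

section \<open>Coefficients of linear pencils\<close>

lemma single_one_neq_zero: "Poly_Mapping.single v (1::nat) \<noteq> 0"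
  by (metis lookup_single_eq lookup_zero one_neq_zero)

lemma single_one_eq_iff:
  "Poly_Mapping.single v (1::nat) = Poly_Mapping.single w 1 \<longleftrightarrow> v = w"
proof
  assume eq: "Poly_Mapping.single v (1::nat) = Poly_Mapping.single w 1"
  have "Poly_Mapping.lookup (Poly_Mapping.single w (1::nat)) v = 1"
    unfolding eq[symmetric] by simp
  then show "v = w"
    by (simp add: lookup_single when_def split: if_splits)
qed simp

lemma lookup_pencil_x_const: "Poly_Mapping.lookup (pencil_x d B0 B) 0 = B0"
  unfolding pencil_x_def const_poly_def var_poly_def lookup_add lookup_sum lookup_single
  by (simp add: when_def single_one_neq_zero[simplified])

lemma lookup_pencil_x_var:
  assumes "p \<in> {1..d}"
  shows "Poly_Mapping.lookup (pencil_x d B0 B) (Poly_Mapping.single (X p) 1) = B p"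
proof -
  have "Poly_Mapping.lookup (pencil_x d B0 B) (Poly_Mapping.single (X p) 1) =
      (\<Sum>q\<in>{1..d}. B q when q = p)"
    by (simp only: pencil_x_def const_poly_def var_poly_def lookup_add lookup_sum lookup_single
        single_one_eq_iff single_one_neq_zero[symmetric] var.inject when_simps add_0_left)
  also have "\<dots> = B p"
    using assms by (simp add: when_def)
  finally show ?thesis .
qed

lemma pencil_x_eq_iff:
  "pencil_x d B0 B = pencil_x d D0 D \<longleftrightarrow> B0 = D0 \<and> (\<forall>p\<in>{1..d}. B p = D p)"
proof
  assume eq: "pencil_x d B0 B = pencil_x d D0 D"
  have "B0 = D0"
    using lookup_pencil_x_const[of d B0 B] lookup_pencil_x_const[of d D0 D] by (simp add: eq)
  moreover have "B p = D p" if "p \<in> {1..d}" for p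
    using lookup_pencil_x_var[OF that, of B0 B] lookup_pencil_x_var[OF that, of D0 D]
    by (simp only: eq)
  ultimately show "B0 = D0 \<and> (\<forall>p\<in>{1..d}. B p = D p)"
    by blast
qed (simp add: pencil_x_def)

lemma const_poly_add_pencil_x: "const_poly S + pencil_x d B0 B = pencil_x d (S + B0) B"
  by (simp add: pencil_x_def const_poly_def single_add add.assoc)

section \<open>Substituting zero for the Y variables\<close>

lemma lookup_y_zero:
  "Poly_Mapping.lookup (y_zero P) \<mu> =
     (Poly_Mapping.lookup P \<mu> when (\<forall>q. Y q \<notin> Poly_Mapping.keys \<mu>))"
  by (auto simp: y_zero_def lookup_sum lookup_single when_def in_keys_iff)

lemma y_zero_zero: "y_zero 0 = 0"
  by (simp add: y_zero_def)

lemma y_zero_add: "y_zero (P + Q) = y_zero P + y_zero Q"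
  by (rule poly_mapping_eqI) (simp add: lookup_y_zero lookup_add when_def)

lemma y_zero_sum: "y_zero (sum P I) = (\<Sum>i\<in>I. y_zero (P i))"
  by (induction I rule: infinite_finite_induct) (simp_all add: y_zero_zero y_zero_add)

lemma y_zero_const_poly: "y_zero (const_poly c) = const_poly c"
  by (rule poly_mapping_eqI) (auto simp: lookup_y_zero const_poly_def lookup_single when_def)

lemma y_zero_var_poly_X: "y_zero (var_poly (X p) c) = var_poly (X p) c"
  by (rule poly_mapping_eqI)
    (auto simp: lookup_y_zero var_poly_def lookup_single when_def split: if_splits)

lemma y_zero_var_poly_Y: "y_zero (var_poly (Y q) c) = 0"
  by (rule poly_mapping_eqI)
    (auto simp: lookup_y_zero var_poly_def lookup_single when_def)

lemma y_zero_pencil_xy: "y_zero (pencil_xy d m A0 A A') = pencil_x d A0 A"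
  by (simp add: pencil_xy_def pencil_x_def y_zero_add y_zero_sum y_zero_const_poly
      y_zero_var_poly_X y_zero_var_poly_Y)

section \<open>Pairing a matrix with a pencil\<close>

lemma block_inner_zero: "block_inner S 0 = 0"
  by (simp add: block_inner_def vec_eq_iff)

lemma block_inner_add: "block_inner S (M + N) = block_inner S M + block_inner S N"
  by (simp add: block_inner_def vec_eq_iff inner_add_right)

text \<open>
  \<open>Poly_Mapping.map\<close> acts only on the coefficients in the support; since the pairing sends \<open>0\<close>
  to \<open>0\<close>, every coefficient is nevertheless obtained by pairing.
\<close>

lemma lookup_block_inner_poly:
  "Poly_Mapping.lookup (block_inner_poly S P) \<mu> = block_inner S (Poly_Mapping.lookup P \<mu>)"
  by (simp add: block_inner_poly_def map.rep_eq when_def block_inner_zero)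

lemma block_inner_poly_zero: "block_inner_poly S 0 = 0"
  by (rule poly_mapping_eqI) (simp add: lookup_block_inner_poly block_inner_zero)

lemma block_inner_poly_add:
  "block_inner_poly S (P + Q) = block_inner_poly S P + block_inner_poly S Q"
  by (rule poly_mapping_eqI) (simp add: lookup_block_inner_poly lookup_add block_inner_add)

lemma block_inner_poly_sum: "block_inner_poly S (sum P I) = (\<Sum>i\<in>I. block_inner_poly S (P i))"
  by (induction I rule: infinite_finite_induct)
    (simp_all add: block_inner_poly_zero block_inner_poly_add)

lemma block_inner_poly_single:
  "block_inner_poly S (Poly_Mapping.single \<mu> c) = Poly_Mapping.single \<mu> (block_inner S c)"
  by (rule poly_mapping_eqI)
    (simp add: lookup_block_inner_poly lookup_single when_def block_inner_zero)

lemma block_inner_poly_pencil_x: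
  "block_inner_poly S (pencil_x d A0 A) = pencil_x d (block_inner S A0) (\<lambda>p. block_inner S (A p))"
  by (simp add: pencil_x_def const_poly_def var_poly_def block_inner_poly_add
      block_inner_poly_sum block_inner_poly_single)

lemma pencil_x_in_trunc_quadratic_module_iff:
  "pencil_x d B0 B \<in> trunc_quadratic_module d m A0 A A' \<longleftrightarrow>
     (\<exists>S S0. psd S \<and> psd S0 \<and> B0 = S0 + block_inner S A0 \<and>
        (\<forall>p\<in>{1..d}. B p = block_inner S (A p)) \<and> (\<forall>q\<in>{1..m}. 0 = block_inner S (A' q)))"
  unfolding trunc_quadratic_module_def y_zero_pencil_xy block_inner_poly_pencil_x
    const_poly_add_pencil_x
  by (subst mem_Collect_eq, subst pencil_x_eq_iff) fastforce

section \<open>Exchanging the two tensor factors\<close>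

definition reindex :: "('a \<Rightarrow> 'b) \<Rightarrow> real^'b^'b \<Rightarrow> real^'a^'a" where
  "reindex f M = (\<chi> r c. M $ f r $ f c)"

lemma reindex_swap_swap: "reindex prod.swap (reindex prod.swap M) = M"
  by (simp add: reindex_def vec_eq_iff)

text \<open>
  The quadratic form of the reindexed matrix at \<open>v\<close> is that of the original one at the vector
  \<open>v\<close> transported along \<open>f\<close>.
\<close>

lemma psd_reindex:
  fixes f :: "'a::finite \<Rightarrow> 'b::finite"
  assumes "bij f" and "psd M"
  shows "psd (reindex f M)"
  unfolding psd_def
proof (intro conjI allI)
  show "symmetric (reindex f M)"
    using assms(2) by (simp add: psd_def symmetric_def reindex_def transpose_def vec_eq_iff)
next
  fix v :: "real^'a"
  define w :: "real^'b" where "w = (\<chi> s. v $ inv f s)"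
  have w: "w $ f r = v $ r" for r
    using assms(1) by (simp add: w_def bij_is_inj)
  have "w \<bullet> (M *v w) = (\<Sum>s\<in>UNIV. \<Sum>t\<in>UNIV. w $ s * (M $ s $ t * w $ t))"
    by (simp add: inner_vec_def matrix_vector_mult_def sum_distrib_left)
  also have "\<dots> = (\<Sum>r\<in>UNIV. \<Sum>t\<in>UNIV. w $ f r * (M $ f r $ t * w $ t))"
    by (rule sum.reindex_bij_betw[OF assms(1), symmetric])
  also have "\<dots> = (\<Sum>r\<in>UNIV. \<Sum>c\<in>UNIV. w $ f r * (M $ f r $ f c * w $ f c))"
    by (intro sum.cong refl sum.reindex_bij_betw[OF assms(1), symmetric])
  also have "\<dots> = v \<bullet> (reindex f M *v v)"
    by (simp add: w inner_vec_def matrix_vector_mult_def reindex_def sum_distrib_left)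
  finally show "0 \<le> v \<bullet> (reindex f M *v v)"
    using assms(2) by (metis psd_def)
qed

lemma psd_reindex_swap: "psd (reindex prod.swap M) \<longleftrightarrow> psd M"
  for M :: "real^('b::finite \<times> 'a::finite)^('b \<times> 'a)"
  using psd_reindex[OF bij_swap, of M] psd_reindex[OF bij_swap, of "reindex prod.swap M"]
  by (auto simp: reindex_swap_swap)

text \<open>
  Both sides have the entry \<open>\<Sum>a b. N a b * C (i, a) (j, b)\<close> at \<open>(i, j)\<close>: on the left the sum is
  an inner product of blocks, on the right it is a linear combination of blocks.
\<close>

lemma block_inner_eq_sum_block_swap:
  "block_inner C N = (\<Sum>a\<in>UNIV. \<Sum>b\<in>UNIV. (N $ a $ b) *\<^sub>R block (reindex prod.swap C) a b)"
  by (simp add: vec_eq_iff block_inner_def block_def reindex_def inner_vec_def mult.commute)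

section \<open>The equivalence\<close>

theorem proposition5p9:
  fixes d m :: nat
    and A0 :: "real^'k^'k" and A A' :: "nat \<Rightarrow> real^'k^'k"
    and B0 :: "real^'l^'l" and B :: "nat \<Rightarrow> real^'l^'l"
  assumes "symmetric A0" and "\<forall>p\<in>{1..d}. symmetric (A p)" and "\<forall>q\<in>{1..m}. symmetric (A' q)"
    and "symmetric B0" and "\<forall>p\<in>{1..d}. symmetric (B p)"
    and "strictly_feasible (pencil_xy d m A0 A A')"
  shows "(pencil_x d B0 B \<in> trunc_quadratic_module d m A0 A A'
          \<longleftrightarrow>
          (\<exists>(C' :: real^('l \<times> 'k)^('l \<times> 'k)) (C0' :: real^'l^'l).
             psd C' \<and> psd C0' \<and>
             B0 = C0' + block_inner C' A0 \<and>
             (\<forall>p\<in>{1..d}. B p = block_inner C' (A p)) \<and>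
             (\<forall>q\<in>{1..m}. 0 = block_inner C' (A' q))))
       \<and> ((\<exists>(C' :: real^('l \<times> 'k)^('l \<times> 'k)) (C0' :: real^'l^'l).
             psd C' \<and> psd C0' \<and>
             B0 = C0' + block_inner C' A0 \<and>
             (\<forall>p\<in>{1..d}. B p = block_inner C' (A p)) \<and>
             (\<forall>q\<in>{1..m}. 0 = block_inner C' (A' q)))
          \<longleftrightarrow>
          (\<exists>(C :: real^('k \<times> 'l)^('k \<times> 'l)) (C0 :: real^'l^'l).
             psd C \<and> psd C0 \<and>
             B0 = C0 + (\<Sum>i\<in>UNIV. \<Sum>j\<in>UNIV. (A0 $ i $ j) *\<^sub>R block C i j) \<and>
             (\<forall>p\<in>{1..d}. B p = (\<Sum>i\<in>UNIV. \<Sum>j\<in>UNIV. (A p $ i $ j) *\<^sub>R block C i j)) \<and>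
             (\<forall>q\<in>{1..m}. 0 = (\<Sum>i\<in>UNIV. \<Sum>j\<in>UNIV. (A' q $ i $ j) *\<^sub>R block C i j))))"
proof (rule conjI)
  let ?swap = "reindex prod.swap :: real^('l \<times> 'k)^('l \<times> 'k) \<Rightarrow> real^('k \<times> 'l)^('k \<times> 'l)"
  \<comment> \<open>The exchange of factors is invertible, so (3) may quantify over exchanged matrices only.\<close>
  have surj: "(\<exists>C. P C) \<longleftrightarrow> (\<exists>C'. P (?swap C'))" for P
    by (metis reindex_swap_swap)
  show "(\<exists>(C' :: real^('l \<times> 'k)^('l \<times> 'k)) (C0' :: real^'l^'l).
             psd C' \<and> psd C0' \<and>
             B0 = C0' + block_inner C' A0 \<and>
             (\<forall>p\<in>{1..d}. B p = block_inner C' (A p)) \<and>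
             (\<forall>q\<in>{1..m}. 0 = block_inner C' (A' q)))
          \<longleftrightarrow>
          (\<exists>(C :: real^('k \<times> 'l)^('k \<times> 'l)) (C0 :: real^'l^'l).
             psd C \<and> psd C0 \<and>
             B0 = C0 + (\<Sum>i\<in>UNIV. \<Sum>j\<in>UNIV. (A0 $ i $ j) *\<^sub>R block C i j) \<and>
             (\<forall>p\<in>{1..d}. B p = (\<Sum>i\<in>UNIV. \<Sum>j\<in>UNIV. (A p $ i $ j) *\<^sub>R block C i j)) \<and>
             (\<forall>q\<in>{1..m}. 0 = (\<Sum>i\<in>UNIV. \<Sum>j\<in>UNIV. (A' q $ i $ j) *\<^sub>R block C i j)))"
    by (subst surj) (simp only: psd_reindex_swap block_inner_eq_sum_block_swap)
qed (rule pencil_x_in_trunc_quadratic_module_iff)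

end
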